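(* Let $(W,S)$ be a finite Coxeter system, $t\in S$ and $I\subset S$. Then for all $b\in X_{I\{t\}}$, $$|W(I,\{t\},b)|=|W(\{t\},I,b^{-1})|.$$
   Context: $\ell$ is the length function. For $I\subset S$, $W_I$ is the subgroup generated by $I$ and $X_I=\{w\in W:\ell(ws)>\ell(w)\ \forall s\in I\}$. Every $w\in W$ factors uniquely as $w=w^Iw_I$ with $w^I\in X_I$, $w_I\in W_I$. For $I,J\subset S$, $X_{IJ}=X_I^{-1}\cap X_J$ with $X_I^{-1}=\{x^{-1}:x\in X_I\}$ (the minimal length representatives of the double cosets $W_I\backslash W/W_J$). For $b\in X_{IJ}$, $$W(I,J,b)=\{w\in W: w^Jb^{-1}=(wb^{-1})_I\}.$$ *)

theory Defs
  imports "HOL-Algebra.Algebra"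
begin

(* Words of the free group on S: the letter (s, True) stands for s, (s, False) for its inverse. *)
type_synonym 'a signed_word = "('a \<times> bool) list"

definition letter_val :: "('a, 'm) monoid_scheme \<Rightarrow> 'a \<times> bool \<Rightarrow> 'a" where
  "letter_val G l = (if snd l then fst l else inv\<^bsub>G\<^esub> (fst l))"

definition word_val :: "('a, 'm) monoid_scheme \<Rightarrow> 'a signed_word \<Rightarrow> 'a" where
  "word_val G xs = foldr (\<lambda>l g. letter_val G l \<otimes>\<^bsub>G\<^esub> g) xs \<one>\<^bsub>G\<^esub>"

(* Equality of two words over S in the quotient of the free group on S by the normal closure of R. *)
inductive word_eq :: "'a set \<Rightarrow> 'a signed_word set \<Rightarrow> 'a signed_word \<Rightarrow> 'a signed_word \<Rightarrow> bool"
  for S :: "'a set" and R :: "'a signed_word set" where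
  refl: "word_eq S R xs xs"
| sym: "word_eq S R xs ys \<Longrightarrow> word_eq S R ys xs"
| trans: "word_eq S R xs ys \<Longrightarrow> word_eq S R ys zs \<Longrightarrow> word_eq S R xs zs"
| cancel: "s \<in> S \<Longrightarrow> word_eq S R (us @ [(s, e), (s, \<not> e)] @ vs) (us @ vs)"
| relator: "r \<in> R \<Longrightarrow> word_eq S R (us @ r @ vs) (us @ vs)"

(* The canonical map from the abstract group presented by S and R to G is an isomorphism. *)
definition presented_by :: "('a, 'm) monoid_scheme \<Rightarrow> 'a set \<Rightarrow> 'a signed_word set \<Rightarrow> bool" where
  "presented_by G S R \<longleftrightarrow>
     generate G S = carrier G \<and>
     (\<forall>xs\<in>lists (S \<times> UNIV). \<forall>ys\<in>lists (S \<times> UNIV).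
        word_val G xs = word_val G ys \<longleftrightarrow> word_eq S R xs ys)"

(* The words (s t)^m(s,t), where m(s,t) is the order of s t. For s t of infinite order,
   group.ord is 0, and the relator is the empty word, i.e. no relation is imposed. *)
definition coxeter_relators :: "('a, 'm) monoid_scheme \<Rightarrow> 'a set \<Rightarrow> 'a signed_word set" where
  "coxeter_relators G S =
     {concat (replicate (group.ord G (s \<otimes>\<^bsub>G\<^esub> t)) [(s, True), (t, True)]) | s t. s \<in> S \<and> t \<in> S}"

locale coxeter_system = group G for G (structure) +
  fixes S :: "'a set"
  assumes gens_in_carrier: "S \<subseteq> carrier G"
    and gens_order: "s \<in> S \<Longrightarrow> ord s = 2"
    and presentation: "presented_by G S (coxeter_relators G S)"

(* Signs are not needed in these words because the generators are involutions. *)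
definition cox_length :: "('a, 'm) monoid_scheme \<Rightarrow> 'a set \<Rightarrow> 'a \<Rightarrow> nat" where
  "cox_length G S w =
     (LEAST n. \<exists>xs. set xs \<subseteq> S \<and> length xs = n \<and> foldr (\<otimes>\<^bsub>G\<^esub>) xs \<one>\<^bsub>G\<^esub> = w)"

definition min_coset_reps :: "('a, 'm) monoid_scheme \<Rightarrow> 'a set \<Rightarrow> 'a set \<Rightarrow> 'a set" where
  "min_coset_reps G S I =
     {w \<in> carrier G. \<forall>s\<in>I. cox_length G S (w \<otimes>\<^bsub>G\<^esub> s) > cox_length G S w}"

(* The pair (w^I, w_I) with w = w^I w_I, w^I in X_I and w_I in W_I = generate G I;
   it exists and is unique for every w in a Coxeter group. *)
definition parabolic_decomp :: "('a, 'm) monoid_scheme \<Rightarrow> 'a set \<Rightarrow> 'a set \<Rightarrow> 'a \<Rightarrow> 'a \<times> 'a" where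
  "parabolic_decomp G S I w =
     (THE p. fst p \<in> min_coset_reps G S I \<and> snd p \<in> generate G I \<and> w = fst p \<otimes>\<^bsub>G\<^esub> snd p)"

definition coset_part :: "('a, 'm) monoid_scheme \<Rightarrow> 'a set \<Rightarrow> 'a set \<Rightarrow> 'a \<Rightarrow> 'a" where
  "coset_part G S I w = fst (parabolic_decomp G S I w)"

definition parabolic_part :: "('a, 'm) monoid_scheme \<Rightarrow> 'a set \<Rightarrow> 'a set \<Rightarrow> 'a \<Rightarrow> 'a" where
  "parabolic_part G S I w = snd (parabolic_decomp G S I w)"

definition min_double_coset_reps ::
    "('a, 'm) monoid_scheme \<Rightarrow> 'a set \<Rightarrow> 'a set \<Rightarrow> 'a set \<Rightarrow> 'a set" where
  "min_double_coset_reps G S I J = m_inv G ` min_coset_reps G S I \<inter> min_coset_reps G S J"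

definition W_set :: "('a, 'm) monoid_scheme \<Rightarrow> 'a set \<Rightarrow> 'a set \<Rightarrow> 'a set \<Rightarrow> 'a \<Rightarrow> 'a set" where
  "W_set G S I J b =
     {w \<in> carrier G. coset_part G S J w \<otimes>\<^bsub>G\<^esub> inv\<^bsub>G\<^esub> b = parabolic_part G S I (w \<otimes>\<^bsub>G\<^esub> inv\<^bsub>G\<^esub> b)}"

end

theory Submission
  imports Defs
begin

text \<open>
The condition defining \<open>W(I,J,b)\<close> says that \<open>w = u b v\<close> with \<open>u\<close> in \<open>W\<^sub>I\<close> and \<open>v\<close> in
\<open>W\<^sub>J\<close>, where \<open>u b\<close> lies in \<open>X\<^sub>J\<close> and the conjugate of \<open>v\<close> by \<open>u b\<close> lies in \<open>X\<^sub>I\<close>; the pair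
\<open>(u, v)\<close> is determined by \<open>w\<close> (\<open>card_W_set\<close>). With \<open>{t}\<close> on either side, one of the two
factors is \<open>\<one>\<close> or \<open>t\<close>, and each cardinality becomes a sum of two counts of elements of \<open>W\<^sub>I\<close>.

These counts are compared by means of the reflection cocycle: \<open>flips w r\<close> is the parity of the
number of times that \<open>r\<close> occurs among the reflections read off from a word for \<open>w\<close>. In terms of
roots, \<open>w\<close> makes the positive root of \<open>r\<close> negative. It is well defined because the Coxeter
relators contribute every reflection an even number of times, it satisfies the cocycle rule
\<open>flips_mult\<close>, and for a generator \<open>s\<close> it says that multiplying by \<open>s\<close> on the right shortens
\<open>w\<close>. Hence membership in \<open>X\<^sub>I\<close> can be computed with Boolean algebra.

Let \<open>r = b t b\<^sup>-\<^sup>1\<close>. If \<open>r\<close> lies in \<open>W\<^sub>I\<close>, the terms coming from \<open>t\<close> vanish on both sides, and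
what remains on either side is the number of \<open>v\<close> in \<open>W\<^sub>I\<close> with \<open>\<not> flips v r\<close>. If \<open>r\<close> does not lie
in \<open>W\<^sub>I\<close>, both cardinalities equal \<open>\<bar>W\<^sub>I\<bar> + \<bar>C\<bar>\<close>, where \<open>C\<close> is the centraliser of \<open>r\<close> in
\<open>W\<^sub>I\<close>. For \<open>W(I,{t},b)\<close> this means that exactly one \<open>W\<^sub>I\<close>-conjugate of \<open>r\<close> lies in \<open>X\<^sub>I\<close> (the
one whose root is antidominant for \<open>I\<close>): one of minimal length does, and as an involution it
is a minimal representative of its double coset of \<open>W\<^sub>I\<close>, which is unique. For
\<open>W({t},I,b\<^sup>-\<^sup>1)\<close> the cocycle rule shows that every \<open>c\<close> in the conjugate of \<open>W\<^sub>I\<close> by \<open>b\<^sup>-\<^sup>1\<close> is counted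
once, except that it is counted twice if it commutes with \<open>t\<close>.
\<close>

section \<open>Conjugation\<close>

context group
begin

definition conjugate :: "'a \<Rightarrow> 'a \<Rightarrow> 'a" where
  "conjugate g r = g \<otimes> r \<otimes> inv g"

lemma conjugate_closed [simp]:
  "\<lbrakk>g \<in> carrier G; r \<in> carrier G\<rbrakk> \<Longrightarrow> conjugate g r \<in> carrier G"
  by (simp add: conjugate_def)

lemma conjugate_one [simp]: "r \<in> carrier G \<Longrightarrow> conjugate \<one> r = r"
  by (simp add: conjugate_def)

lemma conjugate_mult:
  "\<lbrakk>g \<in> carrier G; h \<in> carrier G; r \<in> carrier G\<rbrakk>
    \<Longrightarrow> conjugate (g \<otimes> h) r = conjugate g (conjugate h r)"
  by (simp add: conjugate_def inv_mult_group m_assoc)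

lemma conjugate_inv_cancel [simp]:
  assumes "g \<in> carrier G" "r \<in> carrier G"
  shows "conjugate (inv g) (conjugate g r) = r" "conjugate g (conjugate (inv g) r) = r"
  using assms by (simp_all flip: conjugate_mult)

lemma conjugate_eq_iff:
  assumes "g \<in> carrier G" "r \<in> carrier G" "q \<in> carrier G"
  shows "conjugate g r = q \<longleftrightarrow> r = conjugate (inv g) q"
  using assms by auto

lemma inv_mult_cancel_left [simp]:
  assumes "g \<in> carrier G" "h \<in> carrier G"
  shows "inv g \<otimes> (g \<otimes> h) = h" "g \<otimes> (inv g \<otimes> h) = h"
  using assms by (simp_all flip: m_assoc)

lemma conjugate_self: "g \<in> carrier G \<Longrightarrow> conjugate g g = g"
  by (simp add: conjugate_def m_assoc)

lemma conjugate_in_generate_iff: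
  assumes "I \<subseteq> carrier G" "v \<in> generate G I" "r \<in> carrier G"
  shows "conjugate v r \<in> generate G I \<longleftrightarrow> r \<in> generate G I"
proof -
  have *: "conjugate u q \<in> generate G I" if "u \<in> generate G I" "q \<in> generate G I" for u q
    using that assms(1) by (simp add: conjugate_def generate.eng generate_m_inv_closed)
  have v: "v \<in> carrier G" "inv v \<in> generate G I"
    using assms generate_in_carrier generate_m_inv_closed by auto
  show ?thesis
    using *[OF assms(2), of r] *[OF v(2), of "conjugate v r"] v assms(3) by auto
qed

end

section \<open>Words in the generators\<close>

context coxeter_system
begin

primrec word_prod :: "'a list \<Rightarrow> 'a" where
  "word_prod [] = \<one>"
| "word_prod (s # xs) = s \<otimes> word_prod xs"

lemma foldr_eq_word_prod: "foldr (\<otimes>) xs \<one> = word_prod xs"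
  by (induction xs) auto

lemma gen_closed [simp]: "s \<in> S \<Longrightarrow> s \<in> carrier G"
  using gens_in_carrier by auto

lemma gen_square [simp]: "s \<in> S \<Longrightarrow> s \<otimes> s = \<one>"
  using gens_order[of s] pow_ord_eq_1[of s] by (simp add: numeral_2_eq_2)

lemma gen_inv [simp]: "s \<in> S \<Longrightarrow> inv s = s"
  by (simp add: inv_equality)

lemma gen_not_one: "s \<in> S \<Longrightarrow> s \<noteq> \<one>"
  using gens_order[of s] by auto

lemma word_prod_closed [simp]: "set xs \<subseteq> S \<Longrightarrow> word_prod xs \<in> carrier G"
  by (induction xs) auto

lemma word_prod_append:
  "\<lbrakk>set xs \<subseteq> S; set ys \<subseteq> S\<rbrakk> \<Longrightarrow> word_prod (xs @ ys) = word_prod xs \<otimes> word_prod ys"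
  by (induction xs) (auto simp: m_assoc)

lemma word_prod_rev: "set xs \<subseteq> S \<Longrightarrow> word_prod (rev xs) = inv (word_prod xs)"
  by (induction xs) (auto simp: word_prod_append inv_mult_group)

lemma generate_eq_word_prods:
  assumes "I \<subseteq> S"
  shows "generate G I = word_prod ` {xs. set xs \<subseteq> I}"
proof (intro equalityI subsetI)
  fix g assume "g \<in> generate G I"
  then show "g \<in> word_prod ` {xs. set xs \<subseteq> I}"
  proof induction
    case one
    show ?case by (intro image_eqI[of _ _ "[]"]) auto
  next
    case (incl h)
    then show ?case using assms by (intro image_eqI[of _ _ "[h]"]) auto
  next
    case (inv h)
    then show ?case using assms by (intro image_eqI[of _ _ "[h]"]) auto
  next
    case (eng h1 h2)
    then obtain xs ys where "set xs \<subseteq> I" "set ys \<subseteq> I" "h1 = word_prod xs" "h2 = word_prod ys"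
      by auto
    then show ?case using assms
      by (intro image_eqI[of _ _ "xs @ ys"]) (auto simp: word_prod_append)
  qed
next
  fix g assume "g \<in> word_prod ` {xs. set xs \<subseteq> I}"
  then obtain xs where "set xs \<subseteq> I" "g = word_prod xs" by auto
  moreover have "set xs \<subseteq> I \<Longrightarrow> word_prod xs \<in> generate G I"
    by (induction xs) (auto intro: generate.intros)
  ultimately show "g \<in> generate G I" by simp
qed

lemma carrier_word:
  assumes "w \<in> carrier G" obtains xs where "set xs \<subseteq> S" "w = word_prod xs"
  using assms presentation generate_eq_word_prods[of S]
  unfolding presented_by_def by blast

section \<open>The reflection cocycle\<close>

text \<open>Parity of the number of ways to write \<open>r\<close> as \<open>z\<^sup>-\<^sup>1 s z\<close>, where \<open>s\<close> is a letter of the word and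
\<open>z\<close> the product of the letters after it. The argument \<open>r\<close> ranges over the whole group, not only
over reflections; for other \<open>r\<close> the value is simply \<open>False\<close>.\<close>
primrec word_flips :: "'a list \<Rightarrow> 'a \<Rightarrow> bool" where
  "word_flips [] r = False"
| "word_flips (s # xs) r = (word_flips xs r \<noteq> (conjugate (word_prod xs) r = s))"

lemma word_flips_append:
  assumes "set xs \<subseteq> S" "set ys \<subseteq> S" "r \<in> carrier G"
  shows "word_flips (xs @ ys) r =
    (word_flips ys r \<noteq> word_flips xs (conjugate (word_prod ys) r))"
  using assms by (induction xs) (auto simp: word_prod_append conjugate_mult)

lemma word_prod_alternating:
  assumes "s \<in> S" "t \<in> S"
  shows "word_prod (concat (replicate k [s, t])) = (s \<otimes> t) [^] k"
proof (induction k)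
  case (Suc k)
  then show ?case
    using assms nat_pow_Suc2[of "s \<otimes> t" k] by (simp add: m_assoc del: nat_pow_Suc)
qed simp

text \<open>The reflections read off from \<open>(s t)\<^sup>k\<close>, from right to left, are \<open>(t s)\<^sup>j t\<close> for \<open>j < 2k\<close>:
each occurrence of the pair \<open>s, t\<close> contributes an even and the following odd exponent.\<close>
lemma word_flips_alternating:
  assumes "s \<in> S" "t \<in> S" "r \<in> carrier G"
  shows "word_flips (concat (replicate k [s, t])) r =
    odd (\<Sum>j<2*k. of_bool (r = (t \<otimes> s) [^] j \<otimes> t) :: nat)"
proof (induction k)
  case 0
  show ?case by simp
next
  case (Suc k)
  let ?x = "s \<otimes> t" and ?y = "t \<otimes> s"
  let ?w = "?x [^] k"
  have cl: "s \<in> carrier G" "t \<in> carrier G" using assms by auto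
  have inv_x: "inv ?x = ?y" using assms by (simp add: inv_mult_group)
  have inv_w: "inv ?w = ?y [^] k" using cl inv_x nat_pow_inv[of ?x k] by simp
  have swap: "t \<otimes> ?x [^] n = ?y [^] n \<otimes> t" for n :: nat
  proof (induction n)
    case 0
    show ?case using cl by simp
  next
    case (Suc n)
    have "t \<otimes> ?x [^] Suc n = (t \<otimes> ?x [^] n) \<otimes> ?x" using cl by (simp add: m_assoc)
    also have "\<dots> = ?y [^] n \<otimes> (t \<otimes> ?x)" using cl by (simp add: Suc m_assoc)
    also have "\<dots> = ?y [^] Suc n \<otimes> t" using cl by (simp add: m_assoc)
    finally show ?case .
  qed
  have c1: "conjugate (inv ?w) t = ?y [^] (2*k) \<otimes> t"
  proof -
    have "conjugate (inv ?w) t = ?y [^] k \<otimes> (t \<otimes> ?w)"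
      using cl by (simp add: conjugate_def inv_w[symmetric] m_assoc)
    also have "\<dots> = ?y [^] (k + k) \<otimes> t" using cl by (simp add: swap m_assoc flip: nat_pow_mult)
    finally show ?thesis by (simp add: mult_2)
  qed
  have c2: "conjugate (inv ?w) (conjugate t s) = ?y [^] Suc (2*k) \<otimes> t"
  proof -
    have "conjugate t s = ?y \<otimes> t" using assms by (simp add: conjugate_def)
    then have "conjugate (inv ?w) (conjugate t s) = ?y [^] k \<otimes> ?y \<otimes> (t \<otimes> ?w)"
      using cl by (simp add: conjugate_def inv_w[symmetric] m_assoc)
    also have "\<dots> = (?y [^] Suc k \<otimes> ?y [^] k) \<otimes> t"
      unfolding swap using cl by (simp add: m_assoc)
    also have "\<dots> = ?y [^] (Suc k + k) \<otimes> t"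
      using cl by (simp only: nat_pow_mult m_closed)
    finally show ?thesis by (simp add: mult_2)
  qed
  have "word_flips [s, t] (conjugate ?w r) \<longleftrightarrow>
      (conjugate ?w r = t) \<noteq> (conjugate ?w r = conjugate t s)"
    using assms by (simp add: conjugate_eq_iff)
  also have "\<dots> \<longleftrightarrow> (r = ?y [^] (2*k) \<otimes> t) \<noteq> (r = ?y [^] Suc (2*k) \<otimes> t)"
    using cl assms by (simp add: conjugate_eq_iff c1 c2 del: nat_pow_Suc)
  finally have step: "word_flips [s, t] (conjugate ?w r) \<longleftrightarrow>
      (r = ?y [^] (2*k) \<otimes> t) \<noteq> (r = ?y [^] Suc (2*k) \<otimes> t)" .
  have st: "set (concat (replicate k [s, t])) \<subseteq> S" "set [s, t] \<subseteq> S" using assms by auto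
  have "word_flips (concat (replicate (Suc k) [s, t])) r =
     (word_flips (concat (replicate k [s, t])) r \<noteq> word_flips [s, t] (conjugate ?w r))"
    using word_flips_append[OF st(2,1) assms(3)] word_prod_alternating[OF assms(1,2)]
    by (simp del: word_flips.simps)
  also have "\<dots> = odd (\<Sum>j<2*Suc k. of_bool (r = ?y [^] j \<otimes> t) :: nat)"
    unfolding step Suc.IH by (simp del: nat_pow_Suc)
  finally show ?case .
qed

text \<open>If \<open>m\<close> is the order of \<open>s t\<close>, the sequence \<open>(t s)\<^sup>j t\<close> has period \<open>m\<close> in \<open>j\<close>, so over
\<open>j < 2m\<close> every reflection occurs an even number of times. For infinite order the relator is the
empty word and there is nothing to count.\<close>
lemma word_flips_relator:
  assumes "s \<in> S" "t \<in> S" "r \<in> carrier G"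
  shows "\<not> word_flips (concat (replicate (ord (s \<otimes> t)) [s, t])) r"
proof -
  let ?m = "ord (s \<otimes> t)" and ?y = "t \<otimes> s"
  define f :: "nat \<Rightarrow> nat" where "f j = of_bool (r = ?y [^] j \<otimes> t)" for j
  have cl: "s \<in> carrier G" "t \<in> carrier G" using assms by auto
  have "?y = inv (s \<otimes> t)" using assms by (simp add: inv_mult_group)
  then have y: "?y [^] ?m = \<one>" using cl nat_pow_inv[of "s \<otimes> t" ?m] by simp
  have periodic: "f (?m + j) = f j" for j
    using cl y by (simp add: f_def flip: nat_pow_mult)
  have "(\<Sum>j<?m + n. f j) = (\<Sum>j<?m. f j) + (\<Sum>j<n. f (?m + j))" for n
    by (induction n) auto
  from this[of ?m] have "(\<Sum>j<2 * ?m. f j) = 2 * (\<Sum>j<?m. f j)"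
    by (simp add: periodic mult_2)
  then show ?thesis using word_flips_alternating[OF assms, of ?m] unfolding f_def by simp
qed

lemma word_flips_insert_neutral:
  assumes "set us \<subseteq> S" "set xs \<subseteq> S" "set vs \<subseteq> S"
    and "word_prod xs = \<one>" "\<And>r. r \<in> carrier G \<Longrightarrow> \<not> word_flips xs r" "r \<in> carrier G"
  shows "word_flips (us @ xs @ vs) r = word_flips (us @ vs) r"
  using assms by (auto simp: word_flips_append word_prod_append)

text \<open>The congruence \<open>word_eq\<close> also relates words with letters outside \<open>S\<close>. As its
transitivity rule passes through an arbitrary middle word, the induction needs to know that having
all letters in \<open>S\<close> is preserved as well. The signs of the letters can be dropped because the generators are
involutions.\<close>
lemma word_flips_word_eq:
  assumes "word_eq S (coxeter_relators G S) xs ys"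
  shows "(fst ` set xs \<subseteq> S \<longleftrightarrow> fst ` set ys \<subseteq> S) \<and>
    (fst ` set xs \<subseteq> S \<longrightarrow>
      (\<forall>r\<in>carrier G. word_flips (map fst xs) r = word_flips (map fst ys) r))"
  using assms
proof induction
  case (cancel s us e vs)
  have neutral: "\<not> word_flips [s, s] r" if "r \<in> carrier G" for r
    using cancel that by (simp add: conjugate_eq_iff conjugate_self)
  have "word_flips (map fst us @ [s, s] @ map fst vs) r = word_flips (map fst us @ map fst vs) r"
    if "fst ` set us \<subseteq> S" "fst ` set vs \<subseteq> S" "r \<in> carrier G" for r
    using that cancel neutral by (intro word_flips_insert_neutral) auto
  then show ?case using cancel by (simp add: image_Un)
next
  case (relator w us vs)
  then obtain s t where st: "s \<in> S" "t \<in> S"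
    and w: "w = concat (replicate (ord (s \<otimes> t)) [(s, True), (t, True)])"
    by (auto simp: coxeter_relators_def)
  have fst_w: "map fst w = concat (replicate (ord (s \<otimes> t)) [s, t])"
    by (simp add: w map_concat)
  have "word_prod (map fst w) = \<one>"
    using st by (simp add: fst_w word_prod_alternating)
  moreover have sub: "set (map fst w) \<subseteq> S" using st by (auto simp: fst_w)
  moreover have "\<not> word_flips (map fst w) r" if "r \<in> carrier G" for r
    using word_flips_relator[OF st that] by (simp add: fst_w)
  ultimately have "word_flips (map fst us @ map fst w @ map fst vs) r =
      word_flips (map fst us @ map fst vs) r"
    if "fst ` set us \<subseteq> S" "fst ` set vs \<subseteq> S" "r \<in> carrier G" for r
    using that by (intro word_flips_insert_neutral) auto
  then show ?case using sub by (simp add: image_Un)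
qed auto

lemma word_flips_cong:
  assumes "set xs \<subseteq> S" "set ys \<subseteq> S" "word_prod xs = word_prod ys" "r \<in> carrier G"
  shows "word_flips xs r = word_flips ys r"
proof -
  let ?sg = "map (\<lambda>s. (s, True))"
  have val: "word_val G (?sg zs) = word_prod zs" for zs
    by (induction zs) (auto simp: word_val_def letter_val_def)
  have "?sg xs \<in> lists (S \<times> UNIV)" "?sg ys \<in> lists (S \<times> UNIV)" using assms by auto
  then have "word_eq S (coxeter_relators G S) (?sg xs) (?sg ys)"
    using presentation assms(3) unfolding presented_by_def by (metis val)
  from word_flips_word_eq[OF this] assms show ?thesis
    by (auto simp: image_image comp_def)
qed

text \<open>The reflection cocycle, with \<open>flips w\<close> the characteristic function of the right inversion set of \<open>w\<close>.
Any word for \<open>w\<close> gives the same value, by \<open>flips_word_prod\<close>.\<close>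
definition flips :: "'a \<Rightarrow> 'a \<Rightarrow> bool" where
  "flips w r = word_flips (SOME xs. set xs \<subseteq> S \<and> word_prod xs = w) r"

lemma flips_word_prod:
  assumes "set xs \<subseteq> S" "r \<in> carrier G"
  shows "flips (word_prod xs) r = word_flips xs r"
proof -
  let ?ys = "SOME ys. set ys \<subseteq> S \<and> word_prod ys = word_prod xs"
  have "set ?ys \<subseteq> S \<and> word_prod ?ys = word_prod xs"
    by (rule someI[of _ xs]) (use assms in auto)
  then show ?thesis unfolding flips_def using assms word_flips_cong[of ?ys xs r] by auto
qed

lemma flips_mult:
  assumes "x \<in> carrier G" "y \<in> carrier G" "r \<in> carrier G"
  shows "flips (x \<otimes> y) r = (flips y r \<noteq> flips x (conjugate y r))"
proof -
  obtain xs ys where w: "set xs \<subseteq> S" "x = word_prod xs" "set ys \<subseteq> S" "y = word_prod ys"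
    using assms carrier_word by metis
  show ?thesis
    using w assms flips_word_prod[of "xs @ ys" r]
    by (simp add: flips_word_prod word_flips_append word_prod_append)
qed

lemma flips_one [simp]: "r \<in> carrier G \<Longrightarrow> \<not> flips \<one> r"
  using flips_word_prod[of "[]" r] by simp

lemma flips_gen: "\<lbrakk>s \<in> S; r \<in> carrier G\<rbrakk> \<Longrightarrow> flips s r \<longleftrightarrow> r = s"
  using flips_word_prod[of "[s]" r] by simp

lemma flips_inv:
  assumes "x \<in> carrier G" "r \<in> carrier G"
  shows "flips (inv x) (conjugate x r) = flips x r"
  using flips_mult[of "inv x" x r] assms by simp

lemma flips_mult_gen:
  "\<lbrakk>w \<in> carrier G; s \<in> S\<rbrakk> \<Longrightarrow> flips (w \<otimes> s) s \<longleftrightarrow> \<not> flips w s"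
  by (simp add: flips_mult flips_gen conjugate_self)

text \<open>The strong exchange condition: if \<open>r\<close> is read off from the word an odd number of times, it
is \<open>z\<^sup>-\<^sup>1 s z\<close> for some letter \<open>s\<close> with \<open>z\<close> the product after it, and multiplication by \<open>r\<close> on the right
deletes this letter.\<close>
lemma word_exchange:
  assumes "word_flips xs r" "set xs \<subseteq> S" "r \<in> carrier G"
  shows "\<exists>ys. set ys \<subseteq> set xs \<and> length ys < length xs \<and> word_prod xs \<otimes> r = word_prod ys"
  using assms
proof (induction xs)
  case (Cons s xs)
  show ?case
  proof (cases "word_flips xs r")
    case True
    with Cons obtain ys where ys: "set ys \<subseteq> set xs" "length ys < length xs"
        "word_prod xs \<otimes> r = word_prod ys" by auto
    then show ?thesis using Cons.prems by (intro exI[of _ "s # ys"]) (auto simp: m_assoc)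
  next
    case False
    with Cons.prems have s: "conjugate (word_prod xs) r = s" by auto
    have w: "word_prod xs \<in> carrier G" "s \<in> S" using Cons.prems by auto
    have "word_prod xs \<otimes> r = s \<otimes> word_prod xs"
      using w Cons.prems(3) by (simp flip: s add: conjugate_def m_assoc)
    then have "word_prod (s # xs) \<otimes> r = word_prod xs"
      using w Cons.prems by (simp add: m_assoc) (simp flip: m_assoc)
    then show ?thesis by (intro exI[of _ xs]) auto
  qed
qed simp

section \<open>Length and descents\<close>

lemma length_le: "set xs \<subseteq> S \<Longrightarrow> cox_length G S (word_prod xs) \<le> length xs"
  unfolding cox_length_def foldr_eq_word_prod by (rule Least_le) auto

lemma reduced_word:
  assumes "w \<in> carrier G"
  obtains xs where "set xs \<subseteq> S" "word_prod xs = w" "length xs = cox_length G S w"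
proof -
  have "\<exists>n xs. set xs \<subseteq> S \<and> length xs = n \<and> word_prod xs = w"
    using carrier_word[OF assms] by metis
  from LeastI_ex[OF this] show ?thesis using that unfolding cox_length_def foldr_eq_word_prod by auto
qed

lemma length_inv_le: "w \<in> carrier G \<Longrightarrow> cox_length G S (inv w) \<le> cox_length G S w"
  using reduced_word[of w] length_le word_prod_rev by (metis length_rev set_rev)

lemma length_inv: "w \<in> carrier G \<Longrightarrow> cox_length G S (inv w) = cox_length G S w"
  using length_inv_le[of w] length_inv_le[of "inv w"] by simp

lemma length_decreases:
  assumes "flips w r" "w \<in> carrier G" "r \<in> carrier G"
  shows "cox_length G S (w \<otimes> r) < cox_length G S w"
proof -
  obtain xs where xs: "set xs \<subseteq> S" "word_prod xs = w" "length xs = cox_length G S w"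
    using reduced_word[OF assms(2)] .
  then have "word_flips xs r" using assms flips_word_prod by auto
  then obtain ys where "set ys \<subseteq> set xs" "length ys < length xs" "w \<otimes> r = word_prod ys"
    using word_exchange xs assms(3) by blast
  then show ?thesis using length_le[of ys] xs by fastforce
qed

text \<open>Flipping makes \<open>w s\<close> shorter by the exchange condition. If \<open>w\<close> does not flip \<open>s\<close>, then
\<open>w s\<close> does, and the same argument shows that \<open>w = (w s) s\<close> is shorter than \<open>w s\<close>.\<close>
lemma flips_gen_iff_descent:
  assumes "w \<in> carrier G" "s \<in> S"
  shows "flips w s \<longleftrightarrow> \<not> cox_length G S (w \<otimes> s) > cox_length G S w"
proof (cases "flips w s")
  case True
  then show ?thesis using length_decreases[of w s] assms by auto
next
  case False
  then have "flips (w \<otimes> s) s" using assms by (simp add: flips_mult_gen)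
  from length_decreases[OF this] assms False show ?thesis by (simp add: m_assoc)
qed

lemma min_coset_reps_iff:
  "I \<subseteq> S \<Longrightarrow> x \<in> min_coset_reps G S I \<longleftrightarrow> x \<in> carrier G \<and> (\<forall>s\<in>I. \<not> flips x s)"
  unfolding min_coset_reps_def using flips_gen_iff_descent by auto

section \<open>Standard parabolic subgroups and their cosets\<close>

text \<open>The exchange condition applied to a word in \<open>I\<close> shows that \<open>v r\<close> is again a product of letters
of \<open>I\<close>, so \<open>r = v\<^sup>-\<^sup>1 (v r)\<close> is in \<open>W\<^sub>I\<close>.\<close>
lemma parabolic_flips:
  assumes "I \<subseteq> S" "v \<in> generate G I" "r \<in> carrier G" "flips v r"
  shows "r \<in> generate G I"
proof -
  obtain xs where xs: "set xs \<subseteq> I" "v = word_prod xs"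
    using assms generate_eq_word_prods by auto
  then have S: "set xs \<subseteq> S" using assms by auto
  then obtain ys where ys: "set ys \<subseteq> set xs" "v \<otimes> r = word_prod ys"
    using word_exchange[of xs r] xs assms flips_word_prod by auto
  have I: "I \<subseteq> carrier G" using assms gens_in_carrier by auto
  have v: "v \<in> carrier G" using S xs by auto
  have "v \<otimes> r \<in> generate G I"
    using ys xs assms(1) generate_eq_word_prods by auto
  then have "inv v \<otimes> (v \<otimes> r) \<in> generate G I"
    using assms(2) I by (simp add: generate.eng generate_m_inv_closed)
  then show ?thesis using v assms(3) by (simp flip: m_assoc)
qed

text \<open>The last letter \<open>s\<close> of a shortest word for \<open>v\<close> among the words in \<open>I\<close> is a descent:
otherwise the word without \<open>s\<close> would flip \<open>s\<close>, and the exchange condition would give a word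
for \<open>v\<close> in \<open>I\<close> shorter by two letters.\<close>
lemma parabolic_descent:
  assumes "I \<subseteq> S" "v \<in> generate G I" "v \<noteq> \<one>"
  shows "\<exists>s\<in>I. flips v s"
proof -
  define P where "P xs \<longleftrightarrow> set xs \<subseteq> I \<and> v = word_prod xs" for xs
  have "\<exists>xs. P xs" unfolding P_def using assms generate_eq_word_prods by auto
  then obtain xs where xs: "P xs" and min: "\<And>ys. P ys \<Longrightarrow> length xs \<le> length ys"
    using ex_has_least_nat[of P _ length] by metis
  have "xs \<noteq> []" using xs assms by (auto simp: P_def)
  then obtain zs s where zs: "xs = zs @ [s]" by (cases xs rule: rev_cases) auto
  have s: "s \<in> I" "s \<in> S" "set zs \<subseteq> I" "set zs \<subseteq> S" using xs zs assms by (auto simp: P_def)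
  have v: "v = word_prod zs \<otimes> s" using xs s zs by (simp add: P_def word_prod_append)
  have "flips v s"
  proof (rule ccontr)
    assume "\<not> flips v s"
    then have "word_flips zs s" using s v by (simp add: flips_mult_gen flips_word_prod)
    then obtain ys where "set ys \<subseteq> set zs" "length ys < length zs" "v = word_prod ys"
      using word_exchange[of zs s] s v by auto
    then show False using min[of ys] s zs by (auto simp: P_def)
  qed
  then show ?thesis using s by auto
qed

lemma minimal_in_coset_no_flips:
  assumes "I \<subseteq> S" "x \<in> carrier G"
    and "\<And>v. v \<in> generate G I \<Longrightarrow> cox_length G S x \<le> cox_length G S (x \<otimes> v)"
    and "r \<in> generate G I"
  shows "\<not> flips x r"
  using assms length_decreases[of x r] generate_in_carrier[of I r] gens_in_carrier
  by (metis linorder_not_less subset_trans)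

text \<open>Membership in \<open>X\<^sub>I\<close> only concerns the generators in \<open>I\<close>. An element of minimal length in
its coset satisfies a condition for all of \<open>W\<^sub>I\<close>; the following lemmas show that this is the same.\<close>
lemma exists_minimal_in_coset:
  assumes "I \<subseteq> S" "w \<in> carrier G"
  obtains x u where "x \<in> carrier G" "u \<in> generate G I" "w = x \<otimes> u"
    "\<And>r. r \<in> generate G I \<Longrightarrow> \<not> flips x r"
proof -
  have I: "I \<subseteq> carrier G" using assms gens_in_carrier by auto
  have "\<exists>u. u \<in> generate G I" using generate.one by blast
  then obtain u where u: "u \<in> generate G I"
    and min: "\<And>v. v \<in> generate G I \<Longrightarrow> cox_length G S (w \<otimes> u) \<le> cox_length G S (w \<otimes> v)"
    using ex_has_least_nat[of "\<lambda>u. u \<in> generate G I" _ "\<lambda>u. cox_length G S (w \<otimes> u)"] by metis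
  have uc: "u \<in> carrier G" using u I generate_in_carrier by auto
  have "\<not> flips (w \<otimes> u) r" if "r \<in> generate G I" for r
  proof (rule minimal_in_coset_no_flips[OF assms(1) _ _ that])
    show "w \<otimes> u \<in> carrier G" using assms uc by simp
    fix v assume v: "v \<in> generate G I"
    then have "v \<in> carrier G" using I generate_in_carrier by auto
    then show "cox_length G S (w \<otimes> u) \<le> cox_length G S (w \<otimes> u \<otimes> v)"
      using min[OF generate.eng[OF u v]] uc assms by (simp add: m_assoc)
  qed
  moreover have "inv u \<in> generate G I" using u I generate_m_inv_closed by auto
  moreover have "w = (w \<otimes> u) \<otimes> inv u" using assms uc by (simp add: m_assoc)
  ultimately show ?thesis using that[of "w \<otimes> u" "inv u"] assms uc by auto
qed

text \<open>A descent \<open>s\<close> of \<open>v\<close> in \<open>I\<close> would also be one of \<open>x v\<close>, since \<open>x\<close> does not flip the conjugate of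
\<open>s\<close> by \<open>v\<close>, which is in \<open>W\<^sub>I\<close>.\<close>
lemma min_coset_rep_eq_minimal:
  assumes "I \<subseteq> S" "x \<in> carrier G" "v \<in> generate G I"
    and "\<And>r. r \<in> generate G I \<Longrightarrow> \<not> flips x r"
    and "x \<otimes> v \<in> min_coset_reps G S I"
  shows "v = \<one>"
proof (rule ccontr)
  assume "v \<noteq> \<one>"
  then obtain s where s: "s \<in> I" "flips v s" using parabolic_descent assms by blast
  have I: "I \<subseteq> carrier G" using assms gens_in_carrier by auto
  have cl: "v \<in> carrier G" "s \<in> S" "s \<in> carrier G"
    using s assms I generate_in_carrier by auto
  have "conjugate v s \<in> generate G I"
    using conjugate_in_generate_iff[OF I assms(3)] s cl generate.incl by metis
  then have "flips (x \<otimes> v) s" using assms s cl by (simp add: flips_mult)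
  then show False using assms s by (auto simp: min_coset_reps_iff)
qed

lemma min_coset_rep_no_flips:
  assumes "I \<subseteq> S" "x \<in> min_coset_reps G S I" "r \<in> generate G I"
  shows "\<not> flips x r"
proof -
  have "x \<in> carrier G" using assms by (simp add: min_coset_reps_iff)
  then obtain y u where y: "y \<in> carrier G" "u \<in> generate G I" "x = y \<otimes> u"
    "\<And>r. r \<in> generate G I \<Longrightarrow> \<not> flips y r"
    using exists_minimal_in_coset assms(1) by blast
  then have "u = \<one>" using min_coset_rep_eq_minimal[of I y u] assms by auto
  then show ?thesis using y assms by auto
qed

lemma min_coset_rep_unique:
  assumes "I \<subseteq> S" "x \<in> min_coset_reps G S I" "v \<in> generate G I"
    and "x \<otimes> v \<in> min_coset_reps G S I"
  shows "v = \<one>"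
  using min_coset_rep_eq_minimal[of I x v] min_coset_rep_no_flips[of I x] assms
  by (auto simp: min_coset_reps_iff)

lemma one_min_coset_rep: "I \<subseteq> S \<Longrightarrow> \<one> \<in> min_coset_reps G S I"
  by (auto simp: min_coset_reps_iff)

lemma parabolic_decomp_unique:
  assumes "I \<subseteq> S" "x \<in> min_coset_reps G S I" "u \<in> generate G I"
    and "y \<in> min_coset_reps G S I" "v \<in> generate G I" "x \<otimes> u = y \<otimes> v"
  shows "x = y \<and> u = v"
proof -
  have I: "I \<subseteq> carrier G" using assms gens_in_carrier by auto
  have cl: "x \<in> carrier G" "y \<in> carrier G" "u \<in> carrier G" "v \<in> carrier G"
    using assms I generate_in_carrier by (auto simp: min_coset_reps_iff)
  have "u \<otimes> inv v \<in> generate G I"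
    using assms I by (simp add: generate.eng generate_m_inv_closed)
  moreover have y: "y = x \<otimes> (u \<otimes> inv v)"
    using cl assms(6) by (metis inv_closed inv_solve_right m_assoc m_closed)
  ultimately have "u \<otimes> inv v = \<one>" using min_coset_rep_unique assms by metis
  then have "x = y" using y cl by simp
  then show ?thesis using assms(6) cl by simp
qed

lemma parabolic_decomp_eq:
  assumes "I \<subseteq> S" "x \<in> min_coset_reps G S I" "u \<in> generate G I"
  shows "coset_part G S I (x \<otimes> u) = x" "parabolic_part G S I (x \<otimes> u) = u"
proof -
  have "parabolic_decomp G S I (x \<otimes> u) = (x, u)"
    unfolding parabolic_decomp_def
  proof (rule the_equality)
    fix p assume "fst p \<in> min_coset_reps G S I \<and> snd p \<in> generate G I \<and>
      x \<otimes> u = fst p \<otimes> snd p"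
    then show "p = (x, u)"
      using parabolic_decomp_unique[OF assms, of "fst p" "snd p"] by (metis prod.collapse)
  qed (use assms in simp)
  then show "coset_part G S I (x \<otimes> u) = x" "parabolic_part G S I (x \<otimes> u) = u"
    by (simp_all add: coset_part_def parabolic_part_def)
qed

lemma parabolic_decomp_exists:
  assumes "I \<subseteq> S" "w \<in> carrier G"
  obtains x u where "x \<in> min_coset_reps G S I" "u \<in> generate G I" "w = x \<otimes> u"
  using exists_minimal_in_coset[OF assms] generate.incl[of _ I G] assms(1)
  by (metis min_coset_reps_iff)

text \<open>Induction on the length of a word for \<open>a\<close> in \<open>I\<close>, for all \<open>c\<close>. If \<open>c = \<one>\<close>, the claim is the uniqueness
of minimal coset representatives. Otherwise a descent \<open>s\<close> of \<open>c\<close> in \<open>J\<close> is one of \<open>d' c = a d\<close>,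
and as \<open>d\<close> does not flip \<open>s\<close>, \<open>a\<close> flips \<open>d s d\<^sup>-\<^sup>1\<close>. By the exchange condition, multiplying the equation
by \<open>s\<close> on the right shortens the word for \<open>a\<close>.\<close>
lemma min_double_coset_rep_unique:
  assumes "I \<subseteq> S" "J \<subseteq> S" "d \<in> min_double_coset_reps G S I J" "d' \<in> min_double_coset_reps G S I J"
    and "a \<in> generate G I" "c \<in> generate G J" "a \<otimes> d = d' \<otimes> c"
  shows "d = d'"
proof -
  have J: "J \<subseteq> carrier G" and I: "I \<subseteq> carrier G" using assms gens_in_carrier by auto
  have d: "inv d \<in> min_coset_reps G S I" "d \<in> min_coset_reps G S J"
      "inv d' \<in> min_coset_reps G S I" "d' \<in> min_coset_reps G S J"
    using assms(1-4) by (auto simp: min_double_coset_reps_def min_coset_reps_iff)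
  have cl: "d \<in> carrier G" "d' \<in> carrier G" using d assms by (auto simp: min_coset_reps_iff)
  have "set xs \<subseteq> I \<Longrightarrow> c \<in> generate G J \<Longrightarrow> word_prod xs \<otimes> d = d' \<otimes> c \<Longrightarrow> d = d'" for xs c
  proof (induction "length xs" arbitrary: xs c rule: less_induct)
    case less
    let ?a = "word_prod xs"
    have xs: "set xs \<subseteq> S" using less.prems assms(1) by auto
    have ac: "?a \<in> carrier G" "c \<in> carrier G" "?a \<in> generate G I"
      using less.prems xs generate_in_carrier[OF J] generate_eq_word_prods[OF assms(1)] by auto
    show ?case
    proof (cases "c = \<one>")
      case True
      then have "d' = ?a \<otimes> d" using less.prems cl by simp
      then have "inv d' = inv d \<otimes> inv ?a" using ac cl by (simp add: inv_mult_group)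
      moreover have "inv ?a \<in> generate G I" using ac I generate_m_inv_closed by auto
      ultimately have "inv ?a = \<one>" using min_coset_rep_unique[OF assms(1) d(1)] d(3) by auto
      then have "?a = \<one>" using ac inv_eq_1_iff by blast
      then show ?thesis using \<open>d' = ?a \<otimes> d\<close> cl by simp
    next
      case False
      then obtain s where s: "s \<in> J" "flips c s"
        using parabolic_descent assms(2) less.prems by blast
      have sc: "s \<in> carrier G" "s \<in> generate G J" using s J generate.incl by auto
      have "conjugate c s \<in> generate G J"
        using conjugate_in_generate_iff[OF J less.prems(2)] sc by auto
      then have "flips (d' \<otimes> c) s"
        using min_coset_rep_no_flips[OF assms(2) d(4)] s sc ac cl by (simp add: flips_mult)
      then have "flips ?a (conjugate d s)"
        using min_coset_rep_no_flips[OF assms(2) d(2)] s sc ac cl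
        by (simp add: flips_mult flip: less.prems(3))
      then obtain ys where ys: "set ys \<subseteq> set xs" "length ys < length xs"
          "?a \<otimes> conjugate d s = word_prod ys"
        using word_exchange[OF _ xs, of "conjugate d s"] flips_word_prod[OF xs, of "conjugate d s"]
          sc cl by auto
      have "word_prod ys \<otimes> d = ?a \<otimes> d \<otimes> s"
        using ac cl sc by (simp add: conjugate_def m_assoc flip: ys(3))
      also have "\<dots> = d' \<otimes> (c \<otimes> s)" using less.prems ac cl sc by (simp add: m_assoc)
      finally show ?thesis
        using less.hyps[OF ys(2), of "c \<otimes> s"] ys less.prems generate.eng[OF _ sc(2)] by auto
    qed
  qed
  then show ?thesis using assms(5-7) generate_eq_word_prods[OF assms(1)] by auto
qed

section \<open>Conjugates of a reflection under a parabolic subgroup\<close>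

text \<open>In terms of roots: if the reflections \<open>r\<close> and \<open>s\<close> commute and differ, then \<open>r\<close> fixes the root
of \<open>s\<close>. Here the cocycle is expanded along \<open>r = x t x\<^sup>-\<^sup>1\<close>: the contributions of \<open>x\<close> and \<open>x\<^sup>-\<^sup>1\<close> cancel
because \<open>t\<close> commutes with \<open>q = x\<^sup>-\<^sup>1 s x\<close>, and the generator \<open>t\<close> flips only itself.\<close>
lemma commuting_reflection_no_flip:
  assumes "x \<in> carrier G" "t \<in> S" "r = conjugate x t" "s \<in> carrier G" "s \<noteq> r"
    and "conjugate r s = s"
  shows "\<not> flips r s"
proof -
  define q where "q = conjugate (inv x) s"
  have q: "q \<in> carrier G" "s = conjugate x q" using assms by (auto simp: q_def)
  have r: "r = x \<otimes> t \<otimes> inv x" using assms by (simp add: conjugate_def)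
  (* Cancelling x from r s r^-1 = s, with both sides written as conjugates by x. *)
  have "conjugate x (conjugate t q) = conjugate x q"
    using assms(1,2,4,6) by (simp add: r conjugate_mult q_def)
  then have "conjugate t q = q" using assms(1,2) q(1) by (metis conjugate_closed conjugate_inv_cancel(1) gen_closed)
  moreover have "q \<noteq> t" using assms q by auto
  moreover have "flips r s = (flips (inv x) s \<noteq> (flips t q \<noteq> flips x (conjugate t q)))"
    using assms(1,2,4) by (simp add: r flips_mult conjugate_mult q_def)
  ultimately show ?thesis using q assms(1,2) flips_inv[OF assms(1) q(1)] by (simp add: flips_gen)
qed

text \<open>A conjugate \<open>r\<close> of minimal length will do. Suppose that it has a descent \<open>s\<close> in \<open>I\<close>. Then
\<open>s \<noteq> r\<close>, as \<open>r\<close> is not in \<open>W\<^sub>I\<close>, and so \<open>s\<close> and \<open>r\<close> do not commute. Hence multiplying by \<open>s\<close> on both sides shortens \<open>r\<close> twice, which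
contradicts the choice of \<open>r\<close>.\<close>
lemma reflection_conjugate_min_coset_rep:
  assumes "I \<subseteq> S" "b \<in> carrier G" "t \<in> S" "conjugate b t \<notin> generate G I"
  shows "\<exists>u\<in>generate G I. conjugate (u \<otimes> b) t \<in> min_coset_reps G S I"
proof -
  have I: "I \<subseteq> carrier G" using assms gens_in_carrier by auto
  have "\<exists>u. u \<in> generate G I" using generate.one by blast
  then obtain u where u: "u \<in> generate G I" and min: "\<And>v. v \<in> generate G I \<Longrightarrow>
      cox_length G S (conjugate (u \<otimes> b) t) \<le> cox_length G S (conjugate (v \<otimes> b) t)"
    using ex_has_least_nat[of "\<lambda>u. u \<in> generate G I" _
        "\<lambda>u. cox_length G S (conjugate (u \<otimes> b) t)"] by metis
  define r where "r = conjugate (u \<otimes> b) t"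
  have uc: "u \<in> carrier G" using u I generate_in_carrier by auto
  have cl: "u \<otimes> b \<in> carrier G" "t \<in> carrier G" "r \<in> carrier G"
    using assms uc by (auto simp: r_def)
  have "r \<notin> generate G I"
    using assms uc conjugate_in_generate_iff[OF I u, of "conjugate b t"]
    by (simp add: r_def conjugate_mult)
  have inv_r: "inv r = r"
    using cl(1,2) assms by (simp add: r_def conjugate_def inv_mult_group m_assoc)
  (* Since r is an involution, s r is the inverse of r s and has the same length. *)
  have "\<not> flips r s" if "s \<in> I" for s
  proof
    assume f: "flips r s"
    have s: "s \<in> S" "s \<in> carrier G" "s \<in> generate G I"
      using that assms generate.incl by auto
    then have "s \<noteq> r" using \<open>r \<notin> generate G I\<close> by auto
    then have "conjugate r s \<noteq> s"
      using commuting_reflection_no_flip[OF cl(1) assms(3) r_def s(2)] f by blast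
    then have "flips (s \<otimes> r) s" using f s cl by (simp add: flips_mult flips_gen)
    then have "cox_length G S (s \<otimes> r \<otimes> s) < cox_length G S (s \<otimes> r)"
      using length_decreases s cl by simp
    also have "\<dots> = cox_length G S (r \<otimes> s)"
      using length_inv[of "r \<otimes> s"] s cl inv_r by (simp add: inv_mult_group)
    also have "\<dots> < cox_length G S r" using length_decreases f s cl by simp
    finally have "cox_length G S (conjugate s r) < cox_length G S r"
      using s by (simp add: conjugate_def)
    moreover have "conjugate s r = conjugate (s \<otimes> u \<otimes> b) t"
      using s uc cl assms by (simp add: r_def conjugate_mult m_assoc)
    ultimately show False
      using min[OF generate.eng[OF s(3) u]] by (simp add: r_def)
  qed
  then show ?thesis using u cl assms by (auto simp: r_def min_coset_reps_iff intro!: bexI[of _ u])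
qed

text \<open>A conjugate of \<open>r\<close> in \<open>X\<^sub>I\<close> equals its inverse, so it is a minimal double coset representative,
and all these conjugates lie in the same double coset. Hence there is only one, and the
elements conjugating \<open>r\<close> to it form a left coset of the centraliser of \<open>r\<close> in \<open>W\<^sub>I\<close>.\<close>
lemma card_conjugators_to_min_coset_rep:
  assumes "I \<subseteq> S" "b \<in> carrier G" "t \<in> S" "conjugate b t \<notin> generate G I"
  shows "card {u \<in> generate G I. conjugate (u \<otimes> b) t \<in> min_coset_reps G S I} =
    card {v \<in> generate G I. conjugate v (conjugate b t) = conjugate b t}"
proof -
  define r where "r = conjugate b t"
  have I: "I \<subseteq> carrier G" using assms gens_in_carrier by auto
  note gc = generate_in_carrier[OF I] and gi = generate_m_inv_closed[OF I]
  have cl: "t \<in> carrier G" "r \<in> carrier G" using assms by (auto simp: r_def)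
  have ub: "conjugate (u \<otimes> b) t = conjugate u r" if "u \<in> generate G I" for u
    using that assms gc by (simp add: r_def conjugate_mult)
  obtain u0 where u0: "u0 \<in> generate G I" "conjugate u0 r \<in> min_coset_reps G S I"
    using reflection_conjugate_min_coset_rep[OF assms] ub by auto
  have inv_r: "inv r = r" using cl assms by (simp add: r_def conjugate_def inv_mult_group m_assoc)
  have inv_conj: "inv (conjugate u r) = conjugate u r" if "u \<in> carrier G" for u
    using that cl inv_r by (simp add: conjugate_def inv_mult_group m_assoc)
  have unique: "conjugate u r = conjugate u0 r"
    if u: "u \<in> generate G I" "conjugate u r \<in> min_coset_reps G S I" for u
  proof (rule min_double_coset_rep_unique[OF assms(1) assms(1)])
    show "conjugate u r \<in> min_double_coset_reps G S I I"
      using u inv_conj[of u] gc unfolding min_double_coset_reps_def by (auto intro: rev_image_eqI)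
    show "conjugate u0 r \<in> min_double_coset_reps G S I I"
      using u0 inv_conj[of u0] gc unfolding min_double_coset_reps_def by (auto intro: rev_image_eqI)
    show "u0 \<otimes> inv u \<in> generate G I" using u u0 gi by (simp add: generate.eng)
    then show "u0 \<otimes> inv u \<in> generate G I" .
    show "(u0 \<otimes> inv u) \<otimes> conjugate u r = conjugate u0 r \<otimes> (u0 \<otimes> inv u)"
      using gc[OF u(1)] gc[OF u0(1)] cl
      by (simp add: conjugate_def m_assoc)
  qed
  have "bij_betw (\<lambda>v. u0 \<otimes> v) {v \<in> generate G I. conjugate v r = r}
      {u \<in> generate G I. conjugate u r \<in> min_coset_reps G S I}"
  proof (rule bij_betw_byWitness[where f' = "\<lambda>u. inv u0 \<otimes> u"])
    show "(\<lambda>v. u0 \<otimes> v) ` {v \<in> generate G I. conjugate v r = r}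
        \<subseteq> {u \<in> generate G I. conjugate u r \<in> min_coset_reps G S I}"
      using u0 gc cl by (auto simp: generate.eng conjugate_mult)
    show "(\<lambda>u. inv u0 \<otimes> u) ` {u \<in> generate G I. conjugate u r \<in> min_coset_reps G S I}
        \<subseteq> {v \<in> generate G I. conjugate v r = r}"
    proof clarify
      fix u assume u: "u \<in> generate G I" "conjugate u r \<in> min_coset_reps G S I"
      show "inv u0 \<otimes> u \<in> generate G I \<and> conjugate (inv u0 \<otimes> u) r = r"
        using gc[OF u(1)] gc[OF u0(1)] gi[OF u0(1)] u(1) cl unique[OF u]
        by (simp add: generate.eng conjugate_mult)
    qed
  qed (use u0 gc in \<open>auto simp flip: m_assoc\<close>)
  then have "card {v \<in> generate G I. conjugate v r = r} =
      card {u \<in> generate G I. conjugate u r \<in> min_coset_reps G S I}"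
    by (rule bij_betw_same_card)
  also have "{u \<in> generate G I. conjugate u r \<in> min_coset_reps G S I} =
      {u \<in> generate G I. conjugate (u \<otimes> b) t \<in> min_coset_reps G S I}"
    using ub by auto
  finally show ?thesis by (simp add: r_def)
qed

section \<open>Counting\<close>

text \<open>If \<open>w = x v\<close> with \<open>x\<close> in \<open>X\<^sub>J\<close> and \<open>v\<close> in \<open>W\<^sub>J\<close>, the defining condition says that \<open>u = x b\<^sup>-\<^sup>1\<close> is the
\<open>W\<^sub>I\<close>-part of \<open>w b\<^sup>-\<^sup>1\<close>. Since \<open>w b\<^sup>-\<^sup>1 = (u b v b\<^sup>-\<^sup>1 u\<^sup>-\<^sup>1) u\<close>, the complementary part is the conjugate of \<open>v\<close> by
\<open>u b\<close>.\<close>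
lemma card_W_set:
  assumes "I \<subseteq> S" "J \<subseteq> S" "b \<in> carrier G"
  shows "card (W_set G S I J b) = card {(u, v) \<in> generate G I \<times> generate G J.
    u \<otimes> b \<in> min_coset_reps G S J \<and> conjugate (u \<otimes> b) v \<in> min_coset_reps G S I}"
    (is "_ = card ?P")
proof -
  have I: "I \<subseteq> carrier G" "J \<subseteq> carrier G" using assms gens_in_carrier by auto
  note gc = generate_in_carrier[OF I(1)] generate_in_carrier[OF I(2)]
  have split: "u \<otimes> b \<otimes> v \<otimes> inv b = conjugate (u \<otimes> b) v \<otimes> u"
    if "u \<in> carrier G" "v \<in> carrier G" for u v
    using that assms by (simp add: conjugate_def m_assoc inv_mult_group)
  have "W_set G S I J b = (\<lambda>(u, v). u \<otimes> b \<otimes> v) ` ?P"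
  proof (intro equalityI subsetI)
    fix w assume w: "w \<in> W_set G S I J b"
    then have wc: "w \<in> carrier G" by (simp add: W_set_def)
    obtain x v where x: "x \<in> min_coset_reps G S J" "v \<in> generate G J" "w = x \<otimes> v"
      using parabolic_decomp_exists[OF assms(2) wc] .
    obtain y u where y: "y \<in> min_coset_reps G S I" "u \<in> generate G I" "w \<otimes> inv b = y \<otimes> u"
      using parabolic_decomp_exists[OF assms(1), of "w \<otimes> inv b"] wc assms by auto
    have cl: "x \<in> carrier G" "y \<in> carrier G" "u \<in> carrier G" "v \<in> carrier G"
      using x y gc assms by (auto simp: min_coset_reps_iff)
    have "x \<otimes> inv b = u"
      using w x y parabolic_decomp_eq[OF assms(1) y(1,2)] parabolic_decomp_eq[OF assms(2) x(1,2)]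
      by (simp add: W_set_def)
    then have ub: "u \<otimes> b = x" using cl assms by (auto simp: m_assoc)
    have "y \<otimes> u = conjugate (u \<otimes> b) v \<otimes> u"
      using split[OF cl(3,4)] ub x y by simp
    then have "y = conjugate (u \<otimes> b) v" using cl assms by simp
    then show "w \<in> (\<lambda>(u, v). u \<otimes> b \<otimes> v) ` ?P" using x y ub by auto
  next
    fix w assume "w \<in> (\<lambda>(u, v). u \<otimes> b \<otimes> v) ` ?P"
    then obtain u v where uv: "u \<in> generate G I" "v \<in> generate G J" "w = u \<otimes> b \<otimes> v"
      "u \<otimes> b \<in> min_coset_reps G S J" "conjugate (u \<otimes> b) v \<in> min_coset_reps G S I"
      by auto
    then have cl: "u \<in> carrier G" "v \<in> carrier G" using gc by auto
    have "w \<otimes> inv b = conjugate (u \<otimes> b) v \<otimes> u" using split[OF cl] uv by simp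
    then show "w \<in> W_set G S I J b"
      using uv cl assms parabolic_decomp_eq[OF assms(1) uv(5,1)] parabolic_decomp_eq[OF assms(2) uv(4,2)]
      by (simp add: W_set_def m_assoc)
  qed
  moreover have "inj_on (\<lambda>(u, v). u \<otimes> b \<otimes> v) ?P"
  proof (rule inj_onI, clarify)
    fix u v u' v'
    assume a: "u \<in> generate G I" "v \<in> generate G J" "u' \<in> generate G I" "v' \<in> generate G J"
      "u \<otimes> b \<in> min_coset_reps G S J" "u' \<otimes> b \<in> min_coset_reps G S J"
      "u \<otimes> b \<otimes> v = u' \<otimes> b \<otimes> v'"
    then have "u \<otimes> b = u' \<otimes> b \<and> v = v'" using parabolic_decomp_unique[OF assms(2)] by blast
    then show "u = u' \<and> v = v'" using a assms gc by auto
  qed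
  ultimately show ?thesis by (simp add: card_image)
qed

lemma generate_gen: "t \<in> S \<Longrightarrow> generate G {t} = {\<one>, t}"
proof (intro equalityI subsetI)
  fix g assume t: "t \<in> S" and "g \<in> generate G {t}"
  from this(2) show "g \<in> {\<one>, t}"
  proof induction
    case (eng g h)
    then show ?case using t by (elim insertE emptyE) simp_all
  qed (use t in simp_all)
qed (auto intro: generate.one generate.incl)

lemma card_W_set_singleton_right:
  assumes "finite (carrier G)" "I \<subseteq> S" "t \<in> S" "b \<in> carrier G"
  shows "card (W_set G S I {t} b) = card {u \<in> generate G I. \<not> flips (u \<otimes> b) t} +
    card {u \<in> generate G I. \<not> flips (u \<otimes> b) t \<and> conjugate (u \<otimes> b) t \<in> min_coset_reps G S I}"
proof -
  have I: "I \<subseteq> carrier G" using assms gens_in_carrier by auto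
  have fin: "finite (generate G I)"
    using assms(1) generate_incl[OF I] by (rule finite_subset[rotated])
  let ?A = "{u \<in> generate G I. \<not> flips (u \<otimes> b) t}"
  let ?B = "{u \<in> generate G I. \<not> flips (u \<otimes> b) t \<and> conjugate (u \<otimes> b) t \<in> min_coset_reps G S I}"
  have one: "conjugate (u \<otimes> b) \<one> = \<one>" if "u \<in> generate G I" for u
    using that generate_in_carrier[OF I] assms by (simp add: conjugate_def)
  have "card (W_set G S I {t} b) = card {(u, v) \<in> generate G I \<times> generate G {t}.
      u \<otimes> b \<in> min_coset_reps G S {t} \<and> conjugate (u \<otimes> b) v \<in> min_coset_reps G S I}"
    using card_W_set[of I "{t}" b] assms by simp
  also have "{(u, v) \<in> generate G I \<times> generate G {t}.
      u \<otimes> b \<in> min_coset_reps G S {t} \<and> conjugate (u \<otimes> b) v \<in> min_coset_reps G S I} =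
      ?A \<times> {\<one>} \<union> ?B \<times> {t}"
    using assms generate_in_carrier[OF I] one one_min_coset_rep
    by (auto simp: generate_gen min_coset_reps_iff[of "{t}"])
  also have "card \<dots> = card (?A \<times> {\<one>}) + card (?B \<times> {t})"
    by (rule card_Un_disjoint) (use fin gen_not_one[OF assms(3)] in auto)
  finally show ?thesis by (simp add: card_cartesian_product)
qed

lemma card_W_set_singleton_left:
  assumes "finite (carrier G)" "I \<subseteq> S" "t \<in> S" "c \<in> min_coset_reps G S I"
  shows "card (W_set G S {t} I c) = card {v \<in> generate G I. \<not> flips (conjugate c v) t} +
    (if t \<otimes> c \<in> min_coset_reps G S I
     then card {v \<in> generate G I. \<not> flips (conjugate (t \<otimes> c) v) t} else 0)"
proof -
  have I: "I \<subseteq> carrier G" using assms gens_in_carrier by auto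
  have fin: "finite (generate G I)"
    using assms(1) generate_incl[OF I] by (rule finite_subset[rotated])
  have c: "c \<in> carrier G" using assms by (simp add: min_coset_reps_iff)
  let ?A = "{v \<in> generate G I. \<not> flips (conjugate c v) t}"
  let ?B = "{v \<in> generate G I. t \<otimes> c \<in> min_coset_reps G S I \<and> \<not> flips (conjugate (t \<otimes> c) v) t}"
  have "card (W_set G S {t} I c) = card {(u, v) \<in> generate G {t} \<times> generate G I.
      u \<otimes> c \<in> min_coset_reps G S I \<and> conjugate (u \<otimes> c) v \<in> min_coset_reps G S {t}}"
    using card_W_set[of "{t}" I c] assms c by simp
  also have "{(u, v) \<in> generate G {t} \<times> generate G I.
      u \<otimes> c \<in> min_coset_reps G S I \<and> conjugate (u \<otimes> c) v \<in> min_coset_reps G S {t}} =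
      {\<one>} \<times> ?A \<union> {t} \<times> ?B"
    using assms generate_in_carrier[OF I] c
    by (auto simp: generate_gen min_coset_reps_iff[of "{t}"])
  also have "card \<dots> = card ({\<one>} \<times> ?A) + card ({t} \<times> ?B)"
    by (rule card_Un_disjoint) (use fin gen_not_one[OF assms(3)] in auto)
  finally show ?thesis by (simp add: card_cartesian_product)
qed

lemma flips_conjugate_inv:
  assumes "b \<in> carrier G" "v \<in> carrier G" "t \<in> carrier G"
  shows "flips (conjugate (inv b) v) t =
    ((flips b t \<noteq> flips v (conjugate b t)) \<noteq> flips (inv b) (conjugate v (conjugate b t)))"
  using assms by (simp add: conjugate_def[of "inv b"] flips_mult conjugate_mult)  blast

text \<open>Passing from \<open>c\<close> to \<open>t c t\<close> reverses the value at \<open>t\<close>, unless \<open>c\<close> commutes with \<open>t\<close>.\<close>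
lemma flips_conjugate_gen:
  assumes "c \<in> carrier G" "t \<in> S"
  shows "flips (conjugate t c) t \<longleftrightarrow> (flips c t \<longleftrightarrow> conjugate c t = t)"
  using assms by (simp add: conjugate_def[of t c] flips_mult_gen) (auto simp: flips_mult flips_gen)

text \<open>Here \<open>t b\<^sup>-\<^sup>1 = b\<^sup>-\<^sup>1 r\<close> with \<open>r \<noteq> \<one>\<close> in \<open>W\<^sub>I\<close>, so it is not in \<open>X\<^sub>I\<close>, and no conjugate of \<open>r\<close> by \<open>W\<^sub>I\<close>
is in \<open>X\<^sub>I\<close> because \<open>X\<^sub>I\<close> and \<open>W\<^sub>I\<close> meet only in \<open>\<one>\<close>. By the cocycle rule the conditions in
the remaining terms reduce to \<open>\<not> flips v r\<close>, because \<open>b\<close> does not flip \<open>t\<close> and \<open>b\<^sup>-\<^sup>1\<close> flips no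
element of \<open>W\<^sub>I\<close>.\<close>
lemma card_W_set_reflection_inside:
  assumes "finite (carrier G)" "t \<in> S" "I \<subseteq> S"
    and "b \<in> carrier G" "\<not> flips b t" "inv b \<in> min_coset_reps G S I"
    and "conjugate b t \<in> generate G I"
  shows "card (W_set G S I {t} b) = card (W_set G S {t} I (inv b))"
proof -
  define r where "r = conjugate b t"
  have I: "I \<subseteq> carrier G" using assms gens_in_carrier by auto
  note gc = generate_in_carrier[OF I]
  have cl: "t \<in> carrier G" "r \<in> carrier G" using assms by (auto simp: r_def)
  have r: "r \<in> generate G I" using assms by (simp add: r_def)
  have r1: "r \<noteq> \<one>"
  proof
    assume "r = \<one>"
    then have "t = conjugate (inv b) \<one>" using assms cl by (simp add: r_def conjugate_eq_iff)
    then show False using gen_not_one assms by (simp add: conjugate_def)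
  qed
  have conj_r: "conjugate u r \<in> generate G I" if "u \<in> generate G I" for u
    using conjugate_in_generate_iff[OF I that] r cl by simp
  have ub: "flips (u \<otimes> b) t = flips u r" if "u \<in> generate G I" for u
    using that gc assms cl by (simp add: flips_mult r_def)
  have not_min: "conjugate (u \<otimes> b) t \<notin> min_coset_reps G S I" if u: "u \<in> generate G I" for u
  proof
    assume "conjugate (u \<otimes> b) t \<in> min_coset_reps G S I"
    then have "conjugate u r \<in> min_coset_reps G S I"
      using gc[OF u] assms cl by (simp add: r_def conjugate_mult)
    then have "conjugate u r = \<one>"
      using min_coset_rep_unique[OF assms(3) one_min_coset_rep[OF assms(3)] conj_r[OF u]]
        gc[OF u] cl by simp
    then show False using r1 gc[OF u] cl by (simp add: conjugate_eq_iff) (simp add: conjugate_def)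
  qed
  have tb: "t \<otimes> inv b \<notin> min_coset_reps G S I"
  proof
    assume "t \<otimes> inv b \<in> min_coset_reps G S I"
    moreover have "t \<otimes> inv b = inv b \<otimes> r"
      using assms cl by (simp add: r_def conjugate_def flip: m_assoc)
    ultimately show False using min_coset_rep_unique[OF assms(3,6) r] r1 by simp
  qed
  have vb: "flips (conjugate (inv b) v) t = flips v r" if v: "v \<in> generate G I" for v
    using min_coset_rep_no_flips[OF assms(3,6) conj_r[OF v]] gc[OF v] assms cl
    by (simp add: flips_conjugate_inv flip: r_def)
  have "card (W_set G S I {t} b) = card {u \<in> generate G I. \<not> flips (u \<otimes> b) t}"
    using card_W_set_singleton_right[OF assms(1,3,2,4)] not_min
    by (auto simp: card_eq_0_iff)
  also have "{u \<in> generate G I. \<not> flips (u \<otimes> b) t} =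
      {v \<in> generate G I. \<not> flips (conjugate (inv b) v) t}"
    using ub vb by auto
  also have "card \<dots> = card (W_set G S {t} I (inv b))"
    using card_W_set_singleton_left[OF assms(1,3,2,6)] tb by simp
  finally show ?thesis .
qed

text \<open>No element of \<open>W\<^sub>I\<close> flips \<open>r\<close>. The two terms of \<open>W({t},I,b\<^sup>-\<^sup>1)\<close> count the \<open>v\<close> in
\<open>W\<^sub>I\<close> outside \<open>F\<close> and those in \<open>F \<union> C\<close>, where \<open>F\<close> collects the \<open>v\<close> for which \<open>c = b\<^sup>-\<^sup>1 v b\<close> flips \<open>t\<close>
and \<open>C\<close> those for which \<open>c\<close> commutes with \<open>t\<close>; by \<open>flips_conjugate_gen\<close> the second term would be
the symmetric difference, but \<open>F\<close> and \<open>C\<close> are disjoint.\<close>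
lemma card_W_set_reflection_outside:
  assumes "finite (carrier G)" "t \<in> S" "I \<subseteq> S"
    and "b \<in> carrier G" "\<not> flips b t" "inv b \<in> min_coset_reps G S I"
    and "conjugate b t \<notin> generate G I"
  shows "card (W_set G S I {t} b) = card (W_set G S {t} I (inv b))"
proof -
  define r where "r = conjugate b t"
  define C where "C = {v \<in> generate G I. conjugate v r = r}"
  define F where "F = {v \<in> generate G I. flips (conjugate (inv b) v) t}"
  have I: "I \<subseteq> carrier G" using assms gens_in_carrier by auto
  have fin: "finite (generate G I)"
    using assms(1) generate_incl[OF I] by (rule finite_subset[rotated])
  note gc = generate_in_carrier[OF I]
  have cl: "t \<in> carrier G" "r \<in> carrier G" using assms by (auto simp: r_def)
  have no_flip: "\<not> flips u r" if "u \<in> generate G I" for u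
    using parabolic_flips[OF assms(3) that cl(2)] assms(7) by (auto simp: r_def)
  have ub: "\<not> flips (u \<otimes> b) t" if "u \<in> generate G I" for u
    using no_flip[OF that] gc[OF that] assms cl by (simp add: flips_mult r_def)
  have right: "card (W_set G S I {t} b) = card (generate G I) + card C"
  proof -
    have "{u \<in> generate G I. \<not> flips (u \<otimes> b) t} = generate G I" using ub by auto
    moreover have "{u \<in> generate G I. \<not> flips (u \<otimes> b) t \<and>
        conjugate (u \<otimes> b) t \<in> min_coset_reps G S I} =
        {u \<in> generate G I. conjugate (u \<otimes> b) t \<in> min_coset_reps G S I}" using ub by auto
    ultimately show ?thesis
      using card_W_set_singleton_right[OF assms(1,3,2,4)]
        card_conjugators_to_min_coset_rep[OF assms(3,4,2,7)] by (simp add: C_def r_def)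
  qed
  have tb: "t \<otimes> inv b \<in> min_coset_reps G S I"
  proof -
    have "\<not> flips (t \<otimes> inv b) s" if s: "s \<in> I" for s
    proof -
      have "conjugate (inv b) s \<noteq> t"
        using s assms I generate.incl[OF s, of G] by auto
      then show ?thesis
        using assms s I by (auto simp: flips_mult flips_gen min_coset_reps_iff subset_iff)
    qed
    then show ?thesis using assms cl by (simp add: min_coset_reps_iff)
  qed
  have comm: "conjugate (conjugate (inv b) v) t = t \<longleftrightarrow> conjugate v r = r"
    if "v \<in> generate G I" for v
    using gc[OF that] assms(4) cl
    by (simp add: conjugate_def[of "inv b" v] conjugate_mult conjugate_eq_iff flip: r_def)
  have CF: "v \<notin> F" if "v \<in> C" for v
  proof -
    have v: "v \<in> generate G I" "conjugate v r = r" using that by (auto simp: C_def)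
    then show ?thesis
      using no_flip[OF v(1)] gc[OF v(1)] assms(4,5) cl flips_inv[of b t]
      by (simp add: F_def flips_conjugate_inv flip: r_def)
  qed
  have "flips (conjugate (t \<otimes> inv b) v) t \<longleftrightarrow> v \<notin> F \<union> C" if v: "v \<in> generate G I" for v
  proof -
    have "flips (conjugate (t \<otimes> inv b) v) t \<longleftrightarrow> (v \<in> F \<longleftrightarrow> v \<in> C)"
      using v gc[OF v] comm[OF v] assms(2,4) cl
      by (simp add: conjugate_mult flips_conjugate_gen F_def C_def)
    then show ?thesis using CF by auto
  qed
  then have e: "{v \<in> generate G I. \<not> flips (conjugate (t \<otimes> inv b) v) t} = F \<union> C"
    by (auto simp: F_def C_def)
  have e': "{v \<in> generate G I. \<not> flips (conjugate (inv b) v) t} = generate G I - F"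
    by (auto simp: F_def)
  have finF: "finite F" "finite C" using fin by (auto simp: F_def C_def)
  have "card (W_set G S {t} I (inv b)) = card (generate G I - F) + card (F \<union> C)"
    using card_W_set_singleton_left[OF assms(1,3,2,6)] tb by (simp add: e e')
  also have "card (F \<union> C) = card F + card C"
    using CF finF by (intro card_Un_disjoint) auto
  also have "card (generate G I - F) = card (generate G I) - card F"
    using finF by (intro card_Diff_subset) (auto simp: F_def)
  also have "card (generate G I) - card F + (card F + card C) = card (generate G I) + card C"
    using card_mono[OF fin, of F] by (auto simp: F_def)
  finally show ?thesis using right by simp
qed

end

theorem theorem4p17:
  fixes G :: "('a, 'm) monoid_scheme" and S I :: "'a set" and t b :: 'a
  assumes "coxeter_system G S"
    and "finite (carrier G)"
    and "t \<in> S"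
    and "I \<subseteq> S"
    and "b \<in> min_double_coset_reps G S I {t}"
  shows "card (W_set G S I {t} b) = card (W_set G S {t} I (inv\<^bsub>G\<^esub> b))"
proof -
  interpret coxeter_system G S by fact
  have "b \<in> carrier G" "\<not> flips b t" "inv\<^bsub>G\<^esub> b \<in> min_coset_reps G S I"
    using assms(3-5) by (auto simp: min_double_coset_reps_def min_coset_reps_iff)
  then show ?thesis
    using card_W_set_reflection_inside card_W_set_reflection_outside assms(2-4) by blast
qed

end
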